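(* Let $\mathbb{K}$ be a field of characteristic not $2$ and let $(\mathcal{A},\{-,-\},\alpha)$ be a multiplicative Hom-Lie affgebra over $\mathbb{K}$. For any $o\in\mathcal{A}$ with $\alpha(o)=o$, the fibre space $T_o\mathcal{A}$ together with the unary map $\overrightarrow{\alpha}_o(a)=\alpha(a)$ and the bracket $$[a,b]_o=\langle\{a,b\},\{a,o\},\{o,o\},\{o,b\},o\rangle=\{a,b\}-\{a,o\}+\{o,o\}-\{o,b\}$$ (sums and differences taken in $T_o\mathcal{A}$) is a Hom-Lie algebra. Moreover, for any $o,e\in\mathcal{A}$ with $\alpha(o)=o$ and $\alpha(e)=e$, the Hom-Lie algebras $(T_o\mathcal{A},[-,-]_o,\overrightarrow{\alpha}_o)$ and $(T_e\mathcal{A},[-,-]_e,\overrightarrow{\alpha}_e)$ are isomorphic.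
   Context: An abelian heap is a set $\mathcal{A}$ with a ternary operation $\langle-,-,-\rangle$ satisfying $\langle\langle a,b,c\rangle,d,e\rangle=\langle a,b,\langle c,d,e\rangle\rangle$, $\langle a,a,b\rangle=b=\langle b,a,a\rangle$ and $\langle a,b,c\rangle=\langle c,b,a\rangle$; $\langle a_1,\dots,a_{2n+1}\rangle$ denotes any iterated application of the operation (the result does not depend on bracketing). An affine space over $\mathbb{K}$ is a non-empty abelian heap $\mathcal{A}$ with an action $\mathbb{K}\times\mathcal{A}\times\mathcal{A}\to\mathcal{A}$, $(\xi,a,b)\mapsto\xi\blacktriangleright_a b$, such that: $\xi\blacktriangleright_a-$ and $-\blacktriangleright_a b$ are heap homomorphisms ($\mathbb{K}$ being a heap via $\xi-\zeta+\gamma$); $(\xi\zeta)\blacktriangleright_a b=\xi\blacktriangleright_a(\zeta\blacktriangleright_a b)$; $\xi\blacktriangleright_a b=\langle\xi\blacktriangleright_c b,\xi\blacktriangleright_c a,a\rangle$; $0\blacktriangleright_a b=a$, $1\blacktriangleright_a b=b$. An affine map is a heap homomorphism $f$ with $f(\xi\blacktriangleright_a b)=\xi\blacktriangleright_{f(a)}f(b)$. A map $\mathcal{A}\times\mathcal{A}\to\mathcal{A}$ is bi-affine if it is affine in each argument. For $o\in\mathcal{A}$, the fibre $T_o\mathcal{A}$ is the vector space with underlying set $\mathcal{A}$, addition $a+b=\langle a,o,b\rangle$, scalar multiplication $\xi a=\xi\blacktriangleright_o a$, and zero $o$. A Hom-Lie affgebra is a triple $(\mathcal{A},\{-,-\},\alpha)$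 with $\mathcal{A}$ an affine space, $\{-,-\}:\mathcal{A}\times\mathcal{A}\to\mathcal{A}$ bi-affine, $\alpha:\mathcal{A}\to\mathcal{A}$ affine, such that for all $a,b,c$: $\langle\{a,b\},\{a,a\},\{b,a\}\rangle=\{b,b\}$ and $\langle\{\alpha(a),\{b,c\}\},\{\alpha(a),\{a,a\}\},\{\alpha(b),\{c,a\}\},\{\alpha(b),\{b,b\}\},\{\alpha(c),\{a,b\}\}\rangle=\{\alpha(c),\{c,c\}\}$. It is multiplicative if $\alpha\{a,b\}=\{\alpha(a),\alpha(b)\}$ for all $a,b$. A Hom-Lie algebra is a vector space with a skew-symmetric bilinear bracket $[-,-]$ and a linear map $\alpha$ such that $[\alpha(a),[b,c]]+[\alpha(b),[c,a]]+[\alpha(c),[a,b]]=0$. An isomorphism of Hom-Lie algebras is a linear bijection preserving brackets and intertwining the twisting maps. *)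

theory Defs
  imports "HOL-Algebra.Algebra"
begin

text \<open>All structures live on explicit carrier sets, because one affine space has a different
  vector space structure at each of its points.\<close>

record 'a heap = "'a partial_object" +
  tern :: "'a \<Rightarrow> 'a \<Rightarrow> 'a \<Rightarrow> 'a"

locale abelian_heap =
  fixes A :: "('a, 'm) heap_scheme"
  assumes tern_closed:
      "\<lbrakk>a \<in> carrier A; b \<in> carrier A; c \<in> carrier A\<rbrakk> \<Longrightarrow> tern A a b c \<in> carrier A"
    and tern_assoc:
      "\<lbrakk>a \<in> carrier A; b \<in> carrier A; c \<in> carrier A; d \<in> carrier A; e \<in> carrier A\<rbrakk>
        \<Longrightarrow> tern A (tern A a b c) d e = tern A a b (tern A c d e)"
    and tern_left: "\<lbrakk>a \<in> carrier A; b \<in> carrier A\<rbrakk> \<Longrightarrow> tern A a a b = b"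
    and tern_right: "\<lbrakk>a \<in> carrier A; b \<in> carrier A\<rbrakk> \<Longrightarrow> tern A b a a = b"
    and tern_commute:
      "\<lbrakk>a \<in> carrier A; b \<in> carrier A; c \<in> carrier A\<rbrakk> \<Longrightarrow> tern A a b c = tern A c b a"

definition tern5 :: "('a, 'm) heap_scheme \<Rightarrow> 'a \<Rightarrow> 'a \<Rightarrow> 'a \<Rightarrow> 'a \<Rightarrow> 'a \<Rightarrow> 'a" where
  "tern5 A a b c d e = tern A (tern A a b c) d e"

definition heap_hom :: "('a, 'm) heap_scheme \<Rightarrow> ('b, 'n) heap_scheme \<Rightarrow> ('a \<Rightarrow> 'b) set" where
  "heap_hom A B = {f \<in> carrier A \<rightarrow> carrier B.
     \<forall>a\<in>carrier A. \<forall>b\<in>carrier A. \<forall>c\<in>carrier A. f (tern A a b c) = tern B (f a) (f b) (f c)}"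

definition heap_of_ring :: "('k, 'm) ring_scheme \<Rightarrow> 'k heap" where
  "heap_of_ring K = \<lparr>carrier = carrier K, tern = (\<lambda>x y z. (x \<ominus>\<^bsub>K\<^esub> y) \<oplus>\<^bsub>K\<^esub> z)\<rparr>"

text \<open>The group order is 0 for elements of infinite order, so this is 0 in characteristic 0.\<close>

definition ring_characteristic :: "('k, 'm) ring_scheme \<Rightarrow> nat" where
  "ring_characteristic K = group.ord (add_monoid K) \<one>\<^bsub>K\<^esub>"

text \<open>\<open>act A \<xi> a b\<close> is the action of the scalar \<open>\<xi>\<close> on \<open>b\<close> with base point \<open>a\<close>.\<close>

record ('k, 'a) affine = "'a heap" +
  act :: "'k \<Rightarrow> 'a \<Rightarrow> 'a \<Rightarrow> 'a"

locale affine_space = K?: field K + abelian_heap A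
  for K :: "('k, 'r) ring_scheme" (structure) and A :: "('k, 'a, 'm) affine_scheme" +
  assumes nonempty: "carrier A \<noteq> {}"
    and act_heap_hom_point:
      "\<lbrakk>\<xi> \<in> carrier K; a \<in> carrier A\<rbrakk> \<Longrightarrow> (\<lambda>b. act A \<xi> a b) \<in> heap_hom A A"
    and act_heap_hom_scalar:
      "\<lbrakk>a \<in> carrier A; b \<in> carrier A\<rbrakk> \<Longrightarrow> (\<lambda>\<xi>. act A \<xi> a b) \<in> heap_hom (heap_of_ring K) A"
    and act_mult:
      "\<lbrakk>\<xi> \<in> carrier K; \<zeta> \<in> carrier K; a \<in> carrier A; b \<in> carrier A\<rbrakk>
        \<Longrightarrow> act A (\<xi> \<otimes>\<^bsub>K\<^esub> \<zeta>) a b = act A \<xi> a (act A \<zeta> a b)"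
    and act_base_change:
      "\<lbrakk>\<xi> \<in> carrier K; a \<in> carrier A; b \<in> carrier A; c \<in> carrier A\<rbrakk>
        \<Longrightarrow> act A \<xi> a b = tern A (act A \<xi> c b) (act A \<xi> c a) a"
    and act_zero: "\<lbrakk>a \<in> carrier A; b \<in> carrier A\<rbrakk> \<Longrightarrow> act A \<zero>\<^bsub>K\<^esub> a b = a"
    and act_one: "\<lbrakk>a \<in> carrier A; b \<in> carrier A\<rbrakk> \<Longrightarrow> act A \<one>\<^bsub>K\<^esub> a b = b"

definition affine_map ::
  "('k, 'r) ring_scheme \<Rightarrow> ('k, 'a, 'm) affine_scheme \<Rightarrow> ('k, 'b, 'n) affine_scheme \<Rightarrow> ('a \<Rightarrow> 'b) set"
  where
  "affine_map K A B = {f \<in> heap_hom A B.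
     \<forall>\<xi>\<in>carrier K. \<forall>a\<in>carrier A. \<forall>b\<in>carrier A. f (act A \<xi> a b) = act B \<xi> (f a) (f b)}"

definition bi_affine ::
  "('k, 'r) ring_scheme \<Rightarrow> ('k, 'a, 'm) affine_scheme \<Rightarrow> ('a \<Rightarrow> 'a \<Rightarrow> 'a) \<Rightarrow> bool" where
  "bi_affine K A br \<longleftrightarrow>
     (\<forall>a\<in>carrier A. (\<lambda>b. br a b) \<in> affine_map K A A) \<and>
     (\<forall>b\<in>carrier A. (\<lambda>a. br a b) \<in> affine_map K A A)"

text \<open>\<open>mult\<close> and \<open>one\<close> play no role in a module and are left unspecified.\<close>

definition fibre :: "('k, 'a, 'm) affine_scheme \<Rightarrow> 'a \<Rightarrow> ('k, 'a) module" where
  "fibre A p = \<lparr>carrier = carrier A, monoid.mult = undefined, one = undefined, ring.zero = p,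
     ring.add = (\<lambda>a b. tern A a p b), smult = (\<lambda>\<xi> a. act A \<xi> p a)\<rparr>"

locale hom_lie_affgebra = affine_space K A for K (structure) and A +
  fixes br and \<alpha>
  assumes br_bi_affine: "bi_affine K A br"
    and twist_affine: "\<alpha> \<in> affine_map K A A"
    and affine_antisymmetry:
      "\<lbrakk>a \<in> carrier A; b \<in> carrier A\<rbrakk> \<Longrightarrow> tern A (br a b) (br a a) (br b a) = br b b"
    and affine_hom_Jacobi:
      "\<lbrakk>a \<in> carrier A; b \<in> carrier A; c \<in> carrier A\<rbrakk> \<Longrightarrow>
        tern5 A (br (\<alpha> a) (br b c)) (br (\<alpha> a) (br a a)) (br (\<alpha> b) (br c a))
                (br (\<alpha> b) (br b b)) (br (\<alpha> c) (br a b))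
        = br (\<alpha> c) (br c c)"

locale multiplicative_hom_lie_affgebra = hom_lie_affgebra +
  assumes multiplicative:
    "\<lbrakk>a \<in> carrier A; b \<in> carrier A\<rbrakk> \<Longrightarrow> \<alpha> (br a b) = br (\<alpha> a) (\<alpha> b)"

definition fibre_bracket ::
  "('k, 'a, 'm) affine_scheme \<Rightarrow> ('a \<Rightarrow> 'a \<Rightarrow> 'a) \<Rightarrow> 'a \<Rightarrow> 'a \<Rightarrow> 'a \<Rightarrow> 'a" where
  "fibre_bracket A br p a b = tern5 A (br a b) (br a p) (br p p) (br p b) p"

definition linear_maps ::
  "('k, 'r) ring_scheme \<Rightarrow> ('k, 'a, 'm) module_scheme \<Rightarrow> ('k, 'b, 'n) module_scheme \<Rightarrow> ('a \<Rightarrow> 'b) set"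
  where
  "linear_maps K V W = {f \<in> carrier V \<rightarrow> carrier W.
     (\<forall>x\<in>carrier V. \<forall>y\<in>carrier V. f (x \<oplus>\<^bsub>V\<^esub> y) = f x \<oplus>\<^bsub>W\<^esub> f y) \<and>
     (\<forall>k\<in>carrier K. \<forall>x\<in>carrier V. f (k \<odot>\<^bsub>V\<^esub> x) = k \<odot>\<^bsub>W\<^esub> f x)}"

locale hom_lie_algebra = field K + module K V for K (structure) and V (structure) +
  fixes br and \<alpha>
  assumes br_linear_right: "a \<in> carrier V \<Longrightarrow> (\<lambda>b. br a b) \<in> linear_maps K V V"
    and br_linear_left: "b \<in> carrier V \<Longrightarrow> (\<lambda>a. br a b) \<in> linear_maps K V V"
    and br_skew: "\<lbrakk>a \<in> carrier V; b \<in> carrier V\<rbrakk> \<Longrightarrow> br a b = \<ominus>\<^bsub>V\<^esub> br b a"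
    and twist_linear: "\<alpha> \<in> linear_maps K V V"
    and hom_Jacobi:
      "\<lbrakk>a \<in> carrier V; b \<in> carrier V; c \<in> carrier V\<rbrakk> \<Longrightarrow>
        br (\<alpha> a) (br b c) \<oplus>\<^bsub>V\<^esub> br (\<alpha> b) (br c a) \<oplus>\<^bsub>V\<^esub> br (\<alpha> c) (br a b) = \<zero>\<^bsub>V\<^esub>"

definition hom_lie_isomorphic ::
  "('k, 'r) ring_scheme \<Rightarrow>
   ('k, 'a, 'm) module_scheme \<Rightarrow> ('a \<Rightarrow> 'a \<Rightarrow> 'a) \<Rightarrow> ('a \<Rightarrow> 'a) \<Rightarrow>
   ('k, 'b, 'n) module_scheme \<Rightarrow> ('b \<Rightarrow> 'b \<Rightarrow> 'b) \<Rightarrow> ('b \<Rightarrow> 'b) \<Rightarrow> bool" where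
  "hom_lie_isomorphic K V br \<alpha> W br' \<alpha>' \<longleftrightarrow>
     (\<exists>\<phi>\<in>linear_maps K V W. bij_betw \<phi> (carrier V) (carrier W) \<and>
        (\<forall>a\<in>carrier V. \<forall>b\<in>carrier V. \<phi> (br a b) = br' (\<phi> a) (\<phi> b)) \<and>
        (\<forall>a\<in>carrier V. \<phi> (\<alpha> a) = \<alpha>' (\<phi> a)))"

end

theory Submission
  imports Defs
begin

text \<open>Around a point \<open>p\<close>, taken as the zero of the fibre, a bi-affine bracket splits as
  \<open>{a, b} = [a, b] + \<lambda>(a) + \<rho>(b) + s\<close> with \<open>[-, -]\<close> bilinear, \<open>\<lambda>\<close> and \<open>\<rho>\<close> linear, and
  \<open>s = {p, p}\<close>. The bilinear part is the mixed second difference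
  \<open>{a, b} - {a, p} + {p, p} - {p, b}\<close>, that is, the fibre bracket
  (\<open>fibre_bracket_decomposition\<close>). If \<open>\<alpha>\<close> fixes \<open>p\<close>, then \<open>\<alpha>\<close> is linear on the fibre. So the
  first claim is about vector spaces: the two affine identities for the bracket must imply the
  linear ones for its bilinear part.

  In affine antisymmetry the terms \<open>\<lambda>\<close>, \<open>\<rho>\<close>, \<open>s\<close> cancel, which leaves
  \<open>[a, b] + [b, a] = [a, a] + [b, b]\<close>; with \<open>b = 0\<close> this says that the bracket is alternating.

  The affine Hom-Jacobi identity becomes, after cancellation, the cyclic sum of
  \<open>[\<alpha>(a), {b, c} - {a, a}]\<close> plus \<open>\<rho>([b, c] + [c, a] + [a, b])\<close>, equal to zero. Three instances
  of it give the Hom-Jacobi identity (\<open>bilinear_part_hom_Jacobi\<close>): setting two variables to zero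
  gives \<open>[\<alpha>(a), \<lambda>(a) + \<rho>(a)] = 0\<close>; setting one to zero then gives
  \<open>[\<alpha>(a), \<lambda>(b)] + [\<alpha>(b), \<rho>(a)] + \<rho>([a, b]) = 0\<close>; and the full identity is the linear
  Hom-Jacobi sum plus the three cyclic instances of that relation.

  The isomorphism between the fibres at \<open>p\<close> and \<open>e\<close> is the translation \<open>a \<mapsto> a - p + e\<close>. It is
  linear between the fibres, it preserves the bracket because a mixed difference of a bi-affine
  map depends only on the displacements of its arguments (\<open>fibre_bracket_translation\<close>), and it
  commutes with \<open>\<alpha>\<close> because \<open>\<alpha>\<close> is a heap homomorphism that fixes both \<open>p\<close> and \<open>e\<close>.\<close>

section \<open>Linear maps and the bilinear part of an affine bracket\<close>

lemma (in abelian_group) minus_of_zero: "\<ominus> \<zero> = \<zero>"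
  by (rule minus_equality) simp_all

text \<open>This registers abelian groups as a structure for the \<open>algebra\<close> method, in the way that rings
  are. Its rewriting places \<open>x\<close> next to \<open>\<ominus> x\<close> even if \<open>x\<close> is a compound term; the size of terms
  as an ordering would separate the two and block the cancellation.\<close>

lemmas (in abelian_group) abelian_group_simprules
  [algebra abelian_group "ring.zero G" "ring.add G" "a_inv G" "a_minus G"] =
  a_closed zero_closed a_inv_closed minus_closed a_assoc l_zero l_neg a_comm minus_eq
  r_zero r_neg r_neg2 r_neg1 minus_add minus_minus minus_of_zero a_lcomm

text \<open>The next four identities are the cancellations behind the Hom-Jacobi identity and the
  translation of brackets. Proved once for variables, they avoid normalising the long sums
  in which they occur.\<close>

lemma (in abelian_group) diff_cancel:
  assumes "x \<in> carrier G" "x' \<in> carrier G" "y \<in> carrier G" "y' \<in> carrier G"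
    "c \<in> carrier G" "d \<in> carrier G"
  shows "(x \<oplus> c \<oplus> y \<oplus> d) \<ominus> (x' \<oplus> c \<oplus> y' \<oplus> d) = (x \<ominus> x') \<oplus> (y \<ominus> y')"
  using assms by algebra

lemma (in abelian_group) diff_interchange:
  assumes "a \<in> carrier G" "b \<in> carrier G" "c \<in> carrier G" "d \<in> carrier G"
  shows "(a \<ominus> b) \<ominus> (c \<ominus> d) = (a \<ominus> c) \<ominus> (b \<ominus> d)"
  using assms by algebra

lemma (in abelian_group) telescope3:
  assumes "x \<in> carrier G" "y \<in> carrier G" "z \<in> carrier G"
  shows "(y \<ominus> x) \<oplus> (z \<ominus> y) \<oplus> (x \<ominus> z) = \<zero>"
  using assms by algebra

lemma (in abelian_group) opposite_offsets_cancel: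
  assumes "x \<in> carrier G" "y \<in> carrier G" "z \<in> carrier G" "c \<in> carrier G"
  shows "x \<oplus> (y \<ominus> c) \<oplus> (z \<ominus> \<ominus> c) = x \<oplus> y \<oplus> z"
  using assms by algebra

lemma linear_maps_comp:
  "\<lbrakk>f \<in> linear_maps K U V; g \<in> linear_maps K V W\<rbrakk> \<Longrightarrow> (\<lambda>x. g (f x)) \<in> linear_maps K U W"
  by (auto simp: linear_maps_def Pi_def)

context module
begin

lemma linear_map_closed:
  "\<lbrakk>f \<in> linear_maps R M M; x \<in> carrier M\<rbrakk> \<Longrightarrow> f x \<in> carrier M"
  by (auto simp: linear_maps_def)

lemma linear_map_add:
  "\<lbrakk>f \<in> linear_maps R M M; x \<in> carrier M; y \<in> carrier M\<rbrakk> \<Longrightarrow> f (x \<oplus>\<^bsub>M\<^esub> y) = f x \<oplus>\<^bsub>M\<^esub> f y"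
  by (auto simp: linear_maps_def)

lemma linear_map_zero:
  assumes f: "f \<in> linear_maps R M M"
  shows "f \<zero>\<^bsub>M\<^esub> = \<zero>\<^bsub>M\<^esub>"
proof -
  have "f \<zero>\<^bsub>M\<^esub> \<oplus>\<^bsub>M\<^esub> f \<zero>\<^bsub>M\<^esub> = f \<zero>\<^bsub>M\<^esub>"
    using linear_map_add[OF f, of "\<zero>\<^bsub>M\<^esub>" "\<zero>\<^bsub>M\<^esub>"] by simp
  thus ?thesis
    using linear_map_closed[OF f, of "\<zero>\<^bsub>M\<^esub>"] by simp
qed

lemma linear_map_uminus:
  assumes f: "f \<in> linear_maps R M M" and x: "x \<in> carrier M"
  shows "f (\<ominus>\<^bsub>M\<^esub> x) = \<ominus>\<^bsub>M\<^esub> f x"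
proof -
  have "f (\<ominus>\<^bsub>M\<^esub> x) \<oplus>\<^bsub>M\<^esub> f x = \<zero>\<^bsub>M\<^esub>"
    using linear_map_add[OF f, of "\<ominus>\<^bsub>M\<^esub> x" x] x linear_map_zero[OF f] by (simp add: M.l_neg)
  thus ?thesis
    using linear_map_closed[OF f] x by (metis M.minus_equality M.a_inv_closed)
qed

lemma linear_map_minus:
  "\<lbrakk>f \<in> linear_maps R M M; x \<in> carrier M; y \<in> carrier M\<rbrakk> \<Longrightarrow> f (x \<ominus>\<^bsub>M\<^esub> y) = f x \<ominus>\<^bsub>M\<^esub> f y"
  by (simp add: a_minus_def linear_map_add linear_map_uminus)

lemma linear_maps_cong:
  assumes "g \<in> linear_maps R M M" and eq: "\<And>x. x \<in> carrier M \<Longrightarrow> f x = g x"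
  shows "f \<in> linear_maps R M M"
  using assms by (auto simp: linear_maps_def)

lemma linear_maps_diff:
  assumes f: "f \<in> linear_maps R M M" and g: "g \<in> linear_maps R M M"
  shows "(\<lambda>x. f x \<ominus>\<^bsub>M\<^esub> g x) \<in> linear_maps R M M"
proof -
  have closed: "f x \<in> carrier M" "g x \<in> carrier M" if "x \<in> carrier M" for x
    using that f g by (auto simp: linear_maps_def)
  have "f (x \<oplus>\<^bsub>M\<^esub> y) \<ominus>\<^bsub>M\<^esub> g (x \<oplus>\<^bsub>M\<^esub> y) = (f x \<ominus>\<^bsub>M\<^esub> g x) \<oplus>\<^bsub>M\<^esub> (f y \<ominus>\<^bsub>M\<^esub> g y)"
    if xy: "x \<in> carrier M" "y \<in> carrier M" for x y
    unfolding linear_map_add[OF f xy] linear_map_add[OF g xy]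
    using closed[OF xy(1)] closed[OF xy(2)] by algebra
  moreover have "f (k \<odot>\<^bsub>M\<^esub> x) \<ominus>\<^bsub>M\<^esub> g (k \<odot>\<^bsub>M\<^esub> x) = k \<odot>\<^bsub>M\<^esub> (f x \<ominus>\<^bsub>M\<^esub> g x)"
    if "k \<in> carrier R" "x \<in> carrier M" for k x
    using that f g closed
    by (simp add: linear_maps_def a_minus_def smult_r_distr smult_r_minus)
  ultimately show ?thesis
    using closed by (auto simp: linear_maps_def)
qed

end

text \<open>The linear picture of an affine Lie bracket \<open>br\<close>, seen from one of its points: \<open>lft\<close> and
  \<open>rgt\<close> are the maps \<open>\<lambda>\<close> and \<open>\<rho>\<close> of the introduction.\<close>

locale bilinear_decomposition = module +
  fixes B :: "'c \<Rightarrow> 'c \<Rightarrow> 'c" and lft rgt :: "'c \<Rightarrow> 'c" and s :: 'c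
    and br :: "'c \<Rightarrow> 'c \<Rightarrow> 'c"
  assumes B_linear_right: "x \<in> carrier M \<Longrightarrow> (\<lambda>y. B x y) \<in> linear_maps R M M"
    and B_linear_left: "y \<in> carrier M \<Longrightarrow> (\<lambda>x. B x y) \<in> linear_maps R M M"
    and lft_linear: "lft \<in> linear_maps R M M"
    and rgt_linear: "rgt \<in> linear_maps R M M"
    and s_closed: "s \<in> carrier M"
    and br_decomposition: "\<lbrakk>x \<in> carrier M; y \<in> carrier M\<rbrakk>
      \<Longrightarrow> br x y = B x y \<oplus>\<^bsub>M\<^esub> lft x \<oplus>\<^bsub>M\<^esub> rgt y \<oplus>\<^bsub>M\<^esub> s"
    and antisymmetry: "\<lbrakk>x \<in> carrier M; y \<in> carrier M\<rbrakk>
      \<Longrightarrow> br x y \<ominus>\<^bsub>M\<^esub> br x x \<oplus>\<^bsub>M\<^esub> br y x = br y y"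
begin

lemma B_closed: "\<lbrakk>x \<in> carrier M; y \<in> carrier M\<rbrakk> \<Longrightarrow> B x y \<in> carrier M"
  using linear_map_closed[OF B_linear_right] .

lemmas B_add_right = linear_map_add[OF B_linear_right]
lemmas B_add_left = linear_map_add[OF B_linear_left]
lemmas B_zero_right = linear_map_zero[OF B_linear_right]
lemmas B_zero_left = linear_map_zero[OF B_linear_left]

lemmas part_closed = B_closed linear_map_closed[OF lft_linear] linear_map_closed[OF rgt_linear] s_closed
lemmas part_zero = B_zero_right B_zero_left linear_map_zero[OF lft_linear] linear_map_zero[OF rgt_linear]
lemmas part_add_right = B_add_right linear_map_add[OF rgt_linear]
lemmas B_uminus_right = linear_map_uminus[OF B_linear_right]
lemmas B_minus_right = linear_map_minus[OF B_linear_right]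
lemmas part_minus_right = B_minus_right linear_map_minus[OF rgt_linear]

text \<open>Affine antisymmetry for \<open>x\<close> and the zero vector: every part of \<open>br\<close> that is linear in
  the zero vector vanishes, and of the others only \<open>B x x\<close> fails to cancel.\<close>

lemma bilinear_part_alternating:
  assumes x: "x \<in> carrier M"
  shows "B x x = \<zero>\<^bsub>M\<^esub>"
proof -
  have zero: "lft x \<oplus>\<^bsub>M\<^esub> s \<ominus>\<^bsub>M\<^esub> (B x x \<oplus>\<^bsub>M\<^esub> lft x \<oplus>\<^bsub>M\<^esub> rgt x \<oplus>\<^bsub>M\<^esub> s) \<oplus>\<^bsub>M\<^esub> (rgt x \<oplus>\<^bsub>M\<^esub> s) = s"
    using antisymmetry[of x "\<zero>\<^bsub>M\<^esub>"] x by (simp add: br_decomposition part_zero part_closed)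
  have "B x x = s \<ominus>\<^bsub>M\<^esub>
      (lft x \<oplus>\<^bsub>M\<^esub> s \<ominus>\<^bsub>M\<^esub> (B x x \<oplus>\<^bsub>M\<^esub> lft x \<oplus>\<^bsub>M\<^esub> rgt x \<oplus>\<^bsub>M\<^esub> s) \<oplus>\<^bsub>M\<^esub> (rgt x \<oplus>\<^bsub>M\<^esub> s))"
    using x part_closed by algebra
  also have "\<dots> = \<zero>\<^bsub>M\<^esub>"
    unfolding zero using s_closed by algebra
  finally show ?thesis .
qed

text \<open>Polarisation of the alternating identity.\<close>

lemma bilinear_part_skew:
  assumes x: "x \<in> carrier M" and y: "y \<in> carrier M"
  shows "B x y = \<ominus>\<^bsub>M\<^esub> B y x"
proof -
  have "B (x \<oplus>\<^bsub>M\<^esub> y) (x \<oplus>\<^bsub>M\<^esub> y) = B x y \<oplus>\<^bsub>M\<^esub> B y x"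
    using x y by (simp add: B_add_left B_add_right B_closed bilinear_part_alternating[OF x]
        bilinear_part_alternating[OF y] M.a_comm)
  hence "B x y \<oplus>\<^bsub>M\<^esub> B y x = \<zero>\<^bsub>M\<^esub>"
    using x y bilinear_part_alternating by simp
  thus ?thesis
    using x y B_closed by (metis M.minus_equality)
qed

text \<open>The affine identity holds for all triples, so it may be specialised to triples with zero
  entries. Its degenerate instances are relations between \<open>B\<close>, \<open>lft\<close> and \<open>rgt\<close>; they account
  for everything by which the identity for \<open>x, y, z\<close> differs from the linear one.\<close>

lemma bilinear_part_hom_Jacobi:
  assumes T: "T \<in> linear_maps R M M"
    and Jacobi: "\<And>x y z. \<lbrakk>x \<in> carrier M; y \<in> carrier M; z \<in> carrier M\<rbrakk> \<Longrightarrow>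
      br (T x) (br y z) \<ominus>\<^bsub>M\<^esub> br (T x) (br x x) \<oplus>\<^bsub>M\<^esub> br (T y) (br z x)
        \<ominus>\<^bsub>M\<^esub> br (T y) (br y y) \<oplus>\<^bsub>M\<^esub> br (T z) (br x y) = br (T z) (br z z)"
    and x: "x \<in> carrier M" and y: "y \<in> carrier M" and z: "z \<in> carrier M"
  shows "B (T x) (B y z) \<oplus>\<^bsub>M\<^esub> B (T y) (B z x) \<oplus>\<^bsub>M\<^esub> B (T z) (B x y) = \<zero>\<^bsub>M\<^esub>"
proof -
  note T_closed = linear_map_closed[OF T] and T_zero = linear_map_zero[OF T]
  \<comment> \<open>\<open>v u a b\<close> is the displacement from \<open>br u u\<close> to \<open>br a b\<close>; it contains no \<open>B u u\<close>, as \<open>B\<close> is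
    alternating.\<close>
  define v where "v u a b = B a b \<oplus>\<^bsub>M\<^esub> (lft a \<ominus>\<^bsub>M\<^esub> lft u) \<oplus>\<^bsub>M\<^esub> (rgt b \<ominus>\<^bsub>M\<^esub> rgt u)" for u a b
  have br_in: "br a b \<in> carrier M" if "a \<in> carrier M" "b \<in> carrier M" for a b
    using that by (simp add: br_decomposition part_closed)
  have v_in: "v u a b \<in> carrier M" if "u \<in> carrier M" "a \<in> carrier M" "b \<in> carrier M" for u a b
    using that by (simp add: v_def part_closed)
  have v_eq: "br a b \<ominus>\<^bsub>M\<^esub> br u u = v u a b"
    if u: "u \<in> carrier M" and a: "a \<in> carrier M" and b: "b \<in> carrier M" for u a b
  proof -
    \<comment> \<open>The zeros take the place of the common summand \<open>c\<close> in \<open>diff_cancel\<close>.\<close>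
    have "br a b \<ominus>\<^bsub>M\<^esub> br u u
        = ((B a b \<oplus>\<^bsub>M\<^esub> lft a) \<oplus>\<^bsub>M\<^esub> \<zero>\<^bsub>M\<^esub> \<oplus>\<^bsub>M\<^esub> rgt b \<oplus>\<^bsub>M\<^esub> s) \<ominus>\<^bsub>M\<^esub> (lft u \<oplus>\<^bsub>M\<^esub> \<zero>\<^bsub>M\<^esub> \<oplus>\<^bsub>M\<^esub> rgt u \<oplus>\<^bsub>M\<^esub> s)"
      using u a b by (simp add: br_decomposition part_closed bilinear_part_alternating)
    also have "\<dots> = ((B a b \<oplus>\<^bsub>M\<^esub> lft a) \<ominus>\<^bsub>M\<^esub> lft u) \<oplus>\<^bsub>M\<^esub> (rgt b \<ominus>\<^bsub>M\<^esub> rgt u)"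
      using u a b by (intro M.diff_cancel) (simp_all add: part_closed)
    finally show ?thesis
      using u a b by (simp add: v_def part_closed a_minus_def M.a_assoc)
  qed
  have br_diff: "br (T u) a \<ominus>\<^bsub>M\<^esub> br (T u) b = B (T u) (a \<ominus>\<^bsub>M\<^esub> b) \<oplus>\<^bsub>M\<^esub> rgt (a \<ominus>\<^bsub>M\<^esub> b)"
    if u: "u \<in> carrier M" and a: "a \<in> carrier M" and b: "b \<in> carrier M" for u a b
    using u a b by (simp add: br_decomposition T_closed M.diff_cancel part_closed part_minus_right)
  \<comment> \<open>The parts in \<open>lft\<close> and \<open>rgt\<close> telescope around the cycle.\<close>
  have v_sum: "v a b c \<oplus>\<^bsub>M\<^esub> v b c a \<oplus>\<^bsub>M\<^esub> v c a b = B b c \<oplus>\<^bsub>M\<^esub> B c a \<oplus>\<^bsub>M\<^esub> B a b"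
    if a: "a \<in> carrier M" and b: "b \<in> carrier M" and c: "c \<in> carrier M" for a b c
  proof -
    have "v a b c \<oplus>\<^bsub>M\<^esub> v b c a \<oplus>\<^bsub>M\<^esub> v c a b = (B b c \<oplus>\<^bsub>M\<^esub> B c a \<oplus>\<^bsub>M\<^esub> B a b)
        \<oplus>\<^bsub>M\<^esub> ((lft b \<ominus>\<^bsub>M\<^esub> lft a) \<oplus>\<^bsub>M\<^esub> (lft c \<ominus>\<^bsub>M\<^esub> lft b) \<oplus>\<^bsub>M\<^esub> (lft a \<ominus>\<^bsub>M\<^esub> lft c))
        \<oplus>\<^bsub>M\<^esub> ((rgt a \<ominus>\<^bsub>M\<^esub> rgt b) \<oplus>\<^bsub>M\<^esub> (rgt c \<ominus>\<^bsub>M\<^esub> rgt a) \<oplus>\<^bsub>M\<^esub> (rgt b \<ominus>\<^bsub>M\<^esub> rgt c))"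
      using a b c by (simp add: v_def part_closed M.a_ac)
    thus ?thesis
      using a b c by (simp only: M.telescope3 part_closed) (simp add: part_closed)
  qed
  \<comment> \<open>The affine identity pairs each \<open>br (T u) (br a b)\<close> with \<open>br (T u) (br u u)\<close>; the differences
    are linear in the displacements, and \<open>v_sum\<close> gathers the terms in \<open>rgt\<close>.\<close>
  have cyclic: "B (T a) (v a b c) \<oplus>\<^bsub>M\<^esub> B (T b) (v b c a) \<oplus>\<^bsub>M\<^esub> B (T c) (v c a b)
      \<oplus>\<^bsub>M\<^esub> rgt (B b c \<oplus>\<^bsub>M\<^esub> B c a \<oplus>\<^bsub>M\<^esub> B a b) = \<zero>\<^bsub>M\<^esub>"
    if a: "a \<in> carrier M" and b: "b \<in> carrier M" and c: "c \<in> carrier M" for a b c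
  proof -
    have "B (T a) (v a b c) \<oplus>\<^bsub>M\<^esub> B (T b) (v b c a) \<oplus>\<^bsub>M\<^esub> B (T c) (v c a b)
          \<oplus>\<^bsub>M\<^esub> rgt (B b c \<oplus>\<^bsub>M\<^esub> B c a \<oplus>\<^bsub>M\<^esub> B a b)
        = (B (T a) (v a b c) \<oplus>\<^bsub>M\<^esub> rgt (v a b c)) \<oplus>\<^bsub>M\<^esub> (B (T b) (v b c a) \<oplus>\<^bsub>M\<^esub> rgt (v b c a))
          \<oplus>\<^bsub>M\<^esub> (B (T c) (v c a b) \<oplus>\<^bsub>M\<^esub> rgt (v c a b))"
      using a b c unfolding v_sum[OF a b c, symmetric]
      by (simp add: part_add_right part_closed v_in T_closed M.a_ac)
    also have "\<dots> = (br (T a) (br b c) \<ominus>\<^bsub>M\<^esub> br (T a) (br a a)) \<oplus>\<^bsub>M\<^esub> (br (T b) (br c a) \<ominus>\<^bsub>M\<^esub> br (T b) (br b b))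
          \<oplus>\<^bsub>M\<^esub> (br (T c) (br a b) \<ominus>\<^bsub>M\<^esub> br (T c) (br c c))"
      using a b c by (simp add: br_diff v_eq br_in)
    also have "\<dots> = (br (T a) (br b c) \<ominus>\<^bsub>M\<^esub> br (T a) (br a a) \<oplus>\<^bsub>M\<^esub> br (T b) (br c a)
          \<ominus>\<^bsub>M\<^esub> br (T b) (br b b) \<oplus>\<^bsub>M\<^esub> br (T c) (br a b)) \<ominus>\<^bsub>M\<^esub> br (T c) (br c c)"
      using a b c by (simp add: a_minus_def br_in T_closed M.a_assoc)
    also have "\<dots> = \<zero>\<^bsub>M\<^esub>"
      unfolding Jacobi[OF a b c] using a b c by (simp add: br_in T_closed a_minus_def M.r_neg)
    finally show ?thesis .
  qed
  \<comment> \<open>With two variables zero only the summand with \<open>T a\<close> survives, because \<open>T\<close> fixes zero.\<close>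
  have diagonal: "B (T a) (rgt a) = \<ominus>\<^bsub>M\<^esub> B (T a) (lft a)" if a: "a \<in> carrier M" for a
  proof -
    have "\<ominus>\<^bsub>M\<^esub> (B (T a) (rgt a) \<oplus>\<^bsub>M\<^esub> B (T a) (lft a)) = \<zero>\<^bsub>M\<^esub>"
      using cyclic[of a "\<zero>\<^bsub>M\<^esub>" "\<zero>\<^bsub>M\<^esub>"] a
      by (simp add: v_def part_zero part_closed T_closed T_zero B_add_right B_uminus_right
          a_minus_def M.minus_add M.minus_of_zero M.a_comm)
    hence "B (T a) (rgt a) \<oplus>\<^bsub>M\<^esub> B (T a) (lft a) = \<zero>\<^bsub>M\<^esub>"
      using a by (metis M.minus_minus M.minus_of_zero M.a_closed part_closed(1,2,3) T_closed)
    thus ?thesis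
      using a by (metis M.minus_equality M.minus_minus part_closed(1,2,3) T_closed)
  qed
  \<comment> \<open>The offsets \<open>lft a\<close> and \<open>rgt a\<close> in \<open>v a b c\<close> contribute nothing, by \<open>diagonal\<close>.\<close>
  have B_v: "B (T a) (v a b c) = B (T a) (B b c) \<oplus>\<^bsub>M\<^esub> B (T a) (lft b) \<oplus>\<^bsub>M\<^esub> B (T a) (rgt c)"
    if a: "a \<in> carrier M" and b: "b \<in> carrier M" and c: "c \<in> carrier M" for a b c
  proof -
    have "B (T a) (v a b c) = B (T a) (B b c) \<oplus>\<^bsub>M\<^esub> (B (T a) (lft b) \<ominus>\<^bsub>M\<^esub> B (T a) (lft a))
        \<oplus>\<^bsub>M\<^esub> (B (T a) (rgt c) \<ominus>\<^bsub>M\<^esub> B (T a) (rgt a))"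
      using a b c by (simp add: v_def B_add_right B_minus_right part_closed T_closed)
    also have "\<dots> = B (T a) (B b c) \<oplus>\<^bsub>M\<^esub> B (T a) (lft b) \<oplus>\<^bsub>M\<^esub> B (T a) (rgt c)"
      unfolding diagonal[OF a]
      using a b c by (intro M.opposite_offsets_cancel part_closed T_closed)
    finally show ?thesis .
  qed
  have mixed: "B (T a) (lft b) \<oplus>\<^bsub>M\<^esub> B (T b) (rgt a) \<oplus>\<^bsub>M\<^esub> rgt (B a b) = \<zero>\<^bsub>M\<^esub>"
    if a: "a \<in> carrier M" and b: "b \<in> carrier M" for a b
    using cyclic[OF a b M.zero_closed] a b
    by (simp add: B_v part_zero part_closed T_closed T_zero v_in)
  have "B (T x) (B y z) \<oplus>\<^bsub>M\<^esub> B (T y) (B z x) \<oplus>\<^bsub>M\<^esub> B (T z) (B x y)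
      = (B (T x) (B y z) \<oplus>\<^bsub>M\<^esub> B (T y) (B z x) \<oplus>\<^bsub>M\<^esub> B (T z) (B x y))
        \<oplus>\<^bsub>M\<^esub> (B (T x) (lft y) \<oplus>\<^bsub>M\<^esub> B (T y) (rgt x) \<oplus>\<^bsub>M\<^esub> rgt (B x y))
        \<oplus>\<^bsub>M\<^esub> (B (T y) (lft z) \<oplus>\<^bsub>M\<^esub> B (T z) (rgt y) \<oplus>\<^bsub>M\<^esub> rgt (B y z))
        \<oplus>\<^bsub>M\<^esub> (B (T z) (lft x) \<oplus>\<^bsub>M\<^esub> B (T x) (rgt z) \<oplus>\<^bsub>M\<^esub> rgt (B z x))"
    using x y z by (simp only: mixed) (simp add: part_closed T_closed)
  also have "\<dots> = B (T x) (v x y z) \<oplus>\<^bsub>M\<^esub> B (T y) (v y z x) \<oplus>\<^bsub>M\<^esub> B (T z) (v z x y)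
      \<oplus>\<^bsub>M\<^esub> rgt (B y z \<oplus>\<^bsub>M\<^esub> B z x \<oplus>\<^bsub>M\<^esub> B x y)"
    using x y z by (simp add: B_v part_add_right part_closed T_closed M.a_ac)
  also have "\<dots> = \<zero>\<^bsub>M\<^esub>"
    using cyclic[OF x y z] .
  finally show ?thesis .
qed

end

section \<open>The fibres of an affine space\<close>

lemma fibre_simps:
  "carrier (fibre A p) = carrier A" "\<zero>\<^bsub>fibre A p\<^esub> = p"
  "a \<oplus>\<^bsub>fibre A p\<^esub> b = tern A a p b" "\<xi> \<odot>\<^bsub>fibre A p\<^esub> a = act A \<xi> p a"
  by (simp_all add: fibre_def)

context affine_space
begin

lemma abelian_group_fibre:
  assumes p: "p \<in> carrier A"
  shows "abelian_group (fibre A p)"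
proof (rule abelian_groupI, unfold fibre_simps)
  fix x assume x: "x \<in> carrier A"
  have "tern A (tern A p x p) p x = p"
    using p x by (simp add: tern_assoc tern_left tern_right)
  thus "\<exists>y\<in>carrier A. tern A y p x = p"
    using p x tern_closed by blast
next
  fix x y assume "x \<in> carrier A" "y \<in> carrier A"
  thus "tern A x p y = tern A y p x"
    using p by (intro tern_commute)
qed (use p in \<open>simp_all add: tern_closed tern_assoc tern_left\<close>)

text \<open>The ternary operation is \<open>a - b + c\<close> in every fibre, whatever its base point. This allows
  identities in the heap to be checked in any one fibre.\<close>

lemma tern_in_fibre:
  assumes p: "p \<in> carrier A" and a: "a \<in> carrier A" and b: "b \<in> carrier A" and c: "c \<in> carrier A"
  shows "tern A a b c = a \<ominus>\<^bsub>fibre A p\<^esub> b \<oplus>\<^bsub>fibre A p\<^esub> c"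
proof -
  interpret V: abelian_group "fibre A p"
    using abelian_group_fibre[OF p] .
  have "tern A p b p \<oplus>\<^bsub>fibre A p\<^esub> b = \<zero>\<^bsub>fibre A p\<^esub>"
    using p b by (simp add: fibre_simps tern_assoc tern_left tern_right)
  hence "\<ominus>\<^bsub>fibre A p\<^esub> b = tern A p b p"
    using p b by (intro V.minus_equality) (simp_all add: fibre_simps tern_closed)
  hence "a \<ominus>\<^bsub>fibre A p\<^esub> b = tern A a p (tern A p b p)"
    by (simp add: a_minus_def fibre_simps)
  also have "\<dots> = tern A (tern A a p p) b p"
    using p a b by (simp only: tern_assoc)
  finally show ?thesis
    using p a b c by (simp add: fibre_simps tern_assoc tern_left tern_right)
qed

lemma act_closed:
  "\<lbrakk>\<xi> \<in> carrier K; a \<in> carrier A; b \<in> carrier A\<rbrakk> \<Longrightarrow> act A \<xi> a b \<in> carrier A"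
  using act_heap_hom_point by (auto simp: heap_hom_def)

lemma act_base_point:
  assumes "\<xi> \<in> carrier K" "p \<in> carrier A"
  shows "act A \<xi> p p = p"
  using act_base_change[of \<xi> p p p] assms by (simp add: act_closed tern_left)

lemma act_tern:
  "\<lbrakk>\<xi> \<in> carrier K; p \<in> carrier A; a \<in> carrier A; b \<in> carrier A; c \<in> carrier A\<rbrakk>
    \<Longrightarrow> act A \<xi> p (tern A a b c) = tern A (act A \<xi> p a) (act A \<xi> p b) (act A \<xi> p c)"
  using act_heap_hom_point by (auto simp: heap_hom_def)

lemma act_add_scalar:
  assumes "\<xi> \<in> carrier K" "\<zeta> \<in> carrier K" "p \<in> carrier A" "a \<in> carrier A"
  shows "act A (\<xi> \<oplus> \<zeta>) p a = tern A (act A \<xi> p a) p (act A \<zeta> p a)"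
proof -
  have "act A (\<xi> \<ominus> \<zero> \<oplus> \<zeta>) p a = tern A (act A \<xi> p a) (act A \<zero> p a) (act A \<zeta> p a)"
    using act_heap_hom_scalar assms by (auto simp: heap_hom_def heap_of_ring_def)
  thus ?thesis
    using assms by (simp add: act_zero a_minus_def)
qed

text \<open>Distributivity over vectors uses that \<open>act A \<xi> p\<close> is a heap homomorphism fixing \<open>p\<close>;
  distributivity over scalars uses \<open>\<xi> + \<zeta> = \<xi> - 0 + \<zeta>\<close> in the heap of scalars and \<open>act A 0 p a = p\<close>.\<close>

lemma module_fibre:
  assumes p: "p \<in> carrier A"
  shows "module K (fibre A p)"
  by (rule moduleI[OF K.is_cring abelian_group_fibre[OF p]], unfold fibre_simps)
    (use p in \<open>simp_all add: act_closed act_tern act_add_scalar act_base_point act_mult act_one\<close>)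

lemma affine_map_linear_on_fibres:
  "\<lbrakk>f \<in> affine_map K A A; p \<in> carrier A\<rbrakk> \<Longrightarrow> f \<in> linear_maps K (fibre A p) (fibre A (f p))"
  by (auto simp: affine_map_def heap_hom_def linear_maps_def fibre_simps Pi_def)

text \<open>Compatibility with scalars is the base change axiom, which compares the actions at \<open>p\<close> and
  at \<open>q\<close>.\<close>

lemma translation_linear:
  assumes p: "p \<in> carrier A" and q: "q \<in> carrier A"
  shows "(\<lambda>a. tern A a p q) \<in> linear_maps K (fibre A p) (fibre A q)"
proof -
  have "tern A (tern A a p b) p q = tern A (tern A a p q) q (tern A b p q)"
    if "a \<in> carrier A" "b \<in> carrier A" for a b
    using that p q by (simp add: tern_assoc tern_closed tern_left)
  moreover have "tern A (act A \<xi> p a) p q = act A \<xi> q (tern A a p q)"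
    if "\<xi> \<in> carrier K" "a \<in> carrier A" for \<xi> a
    using that p q act_base_change[of \<xi> q "tern A a p q" p]
    by (simp add: tern_closed act_closed act_tern act_base_point tern_assoc tern_left)
  ultimately show ?thesis
    using p q by (auto simp: linear_maps_def fibre_simps tern_closed)
qed

lemma translation_bij:
  assumes p: "p \<in> carrier A" and q: "q \<in> carrier A"
  shows "bij_betw (\<lambda>a. tern A a p q) (carrier A) (carrier A)"
  by (rule bij_betw_byWitness[where f' = "\<lambda>a. tern A a q p"])
    (use p q in \<open>auto simp: tern_closed tern_assoc tern_left tern_right\<close>)

text \<open>The map \<open>f\<close> is linear from the fibre at \<open>p\<close> to the fibre at \<open>f p\<close>; translation carries the
  latter back to the fibre at \<open>p\<close>.\<close>

lemma affine_map_linear_part: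
  assumes f: "f \<in> affine_map K A A" and p: "p \<in> carrier A"
  shows "(\<lambda>a. f a \<ominus>\<^bsub>fibre A p\<^esub> f p) \<in> linear_maps K (fibre A p) (fibre A p)"
proof -
  interpret V: module K "fibre A p"
    using module_fibre[OF p] .
  have f_closed: "f a \<in> carrier A" if "a \<in> carrier A" for a
    using f that by (auto simp: affine_map_def heap_hom_def)
  have translated: "(\<lambda>a. tern A (f a) (f p) p) \<in> linear_maps K (fibre A p) (fibre A p)"
    by (rule linear_maps_comp[OF affine_map_linear_on_fibres[OF f p]
          translation_linear[OF f_closed[OF p] p]])
  show ?thesis
  proof (rule V.linear_maps_cong[OF translated])
    fix a assume "a \<in> carrier (fibre A p)"
    hence a: "f a \<in> carrier A"
      by (simp add: fibre_simps f_closed)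
    have "tern A (f a) (f p) p = f a \<ominus>\<^bsub>fibre A p\<^esub> f p \<oplus>\<^bsub>fibre A p\<^esub> \<zero>\<^bsub>fibre A p\<^esub>"
      using tern_in_fibre[OF p a f_closed[OF p] p] by (simp only: fibre_simps(2))
    also have "\<dots> = f a \<ominus>\<^bsub>fibre A p\<^esub> f p"
      using a f_closed[OF p] by (intro V.M.r_zero V.M.minus_closed) (simp_all add: fibre_simps)
    finally show "f a \<ominus>\<^bsub>fibre A p\<^esub> f p = tern A (f a) (f p) p"
      by simp
  qed
qed

end

section \<open>The bracket on a fibre\<close>

context hom_lie_affgebra
begin

lemma br_right_affine: "a \<in> carrier A \<Longrightarrow> (\<lambda>b. br a b) \<in> affine_map K A A"
  using br_bi_affine by (simp add: bi_affine_def)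

lemma br_left_affine: "b \<in> carrier A \<Longrightarrow> (\<lambda>a. br a b) \<in> affine_map K A A"
  using br_bi_affine by (simp add: bi_affine_def)

lemma br_closed: "\<lbrakk>a \<in> carrier A; b \<in> carrier A\<rbrakk> \<Longrightarrow> br a b \<in> carrier A"
  using br_right_affine[of a] by (auto simp: affine_map_def heap_hom_def)

lemma twist_closed: "a \<in> carrier A \<Longrightarrow> \<alpha> a \<in> carrier A"
  using twist_affine by (auto simp: affine_map_def heap_hom_def)

lemma br_tern_right:
  "\<lbrakk>x \<in> carrier A; a \<in> carrier A; b \<in> carrier A; c \<in> carrier A\<rbrakk>
    \<Longrightarrow> br x (tern A a b c) = tern A (br x a) (br x b) (br x c)"
  using br_right_affine by (auto simp: affine_map_def heap_hom_def)

lemma br_tern_left: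
  "\<lbrakk>x \<in> carrier A; a \<in> carrier A; b \<in> carrier A; c \<in> carrier A\<rbrakk>
    \<Longrightarrow> br (tern A a b c) x = tern A (br a x) (br b x) (br c x)"
  using br_left_affine by (auto simp: affine_map_def heap_hom_def)

text \<open>The fifth entry of the heap expression is the zero of the fibre and drops out.\<close>

lemma fibre_bracket_eq:
  assumes p: "p \<in> carrier A" and a: "a \<in> carrier A" and b: "b \<in> carrier A"
  shows "fibre_bracket A br p a b
    = br a b \<ominus>\<^bsub>fibre A p\<^esub> br a p \<oplus>\<^bsub>fibre A p\<^esub> br p p \<ominus>\<^bsub>fibre A p\<^esub> br p b"
proof -
  interpret V: abelian_group "fibre A p"
    using abelian_group_fibre[OF p] .
  have "fibre_bracket A br p a b
      = br a b \<ominus>\<^bsub>fibre A p\<^esub> br a p \<oplus>\<^bsub>fibre A p\<^esub> br p p \<ominus>\<^bsub>fibre A p\<^esub> br p b \<oplus>\<^bsub>fibre A p\<^esub> p"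
    unfolding fibre_bracket_def tern5_def
    using p a b by (simp add: tern_in_fibre[OF p, symmetric] br_closed tern_closed)
  also have "\<dots> = br a b \<ominus>\<^bsub>fibre A p\<^esub> br a p \<oplus>\<^bsub>fibre A p\<^esub> br p p \<ominus>\<^bsub>fibre A p\<^esub> br p b \<oplus>\<^bsub>fibre A p\<^esub> \<zero>\<^bsub>fibre A p\<^esub>"
    by (simp only: fibre_simps(2))
  also have "\<dots> = br a b \<ominus>\<^bsub>fibre A p\<^esub> br a p \<oplus>\<^bsub>fibre A p\<^esub> br p p \<ominus>\<^bsub>fibre A p\<^esub> br p b"
    by (intro V.r_zero V.minus_closed V.a_closed) (simp_all add: fibre_simps(1) br_closed p a b)
  finally show ?thesis .
qed

text \<open>Linearity in either argument is read off from one of the two ways to group the mixed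
  difference: as a difference of the linear parts of \<open>br a\<close> and \<open>br p\<close>, or of those of
  \<open>\<lambda>a. br a b\<close> and \<open>\<lambda>a. br a p\<close>.\<close>

lemma fibre_bracket_decomposition:
  assumes p: "p \<in> carrier A"
  shows "bilinear_decomposition K (fibre A p) (fibre_bracket A br p)
    (\<lambda>a. br a p \<ominus>\<^bsub>fibre A p\<^esub> br p p) (\<lambda>b. br p b \<ominus>\<^bsub>fibre A p\<^esub> br p p) (br p p) br"
proof -
  interpret V: module K "fibre A p"
    using module_fibre[OF p] .
  have br_fibre: "br a b \<in> carrier (fibre A p)"
    if "a \<in> carrier (fibre A p)" "b \<in> carrier (fibre A p)" for a b
    using that by (simp add: fibre_simps br_closed)
  have pV: "p \<in> carrier (fibre A p)"
    using p by (simp add: fibre_simps)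
  note eq = fibre_bracket_eq[OF p, folded fibre_simps(1)[of A p]]
  have right: "(\<lambda>b. br a b \<ominus>\<^bsub>fibre A p\<^esub> br a p) \<in> linear_maps K (fibre A p) (fibre A p)"
    if "a \<in> carrier (fibre A p)" for a
    using affine_map_linear_part[OF br_right_affine p] that by (simp add: fibre_simps)
  have left: "(\<lambda>a. br a b \<ominus>\<^bsub>fibre A p\<^esub> br p b) \<in> linear_maps K (fibre A p) (fibre A p)"
    if "b \<in> carrier (fibre A p)" for b
    using affine_map_linear_part[OF br_left_affine p] that by (simp add: fibre_simps)
  show ?thesis
  proof (intro bilinear_decomposition.intro bilinear_decomposition_axioms.intro)
    show "module K (fibre A p)" ..
  next
    fix a assume a: "a \<in> carrier (fibre A p)"
    show "(\<lambda>b. fibre_bracket A br p a b) \<in> linear_maps K (fibre A p) (fibre A p)"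
    proof (rule V.linear_maps_cong[OF V.linear_maps_diff[OF right[OF a] right[OF pV]]])
      fix b assume b: "b \<in> carrier (fibre A p)"
      show "fibre_bracket A br p a b
          = br a b \<ominus>\<^bsub>fibre A p\<^esub> br a p \<ominus>\<^bsub>fibre A p\<^esub> (br p b \<ominus>\<^bsub>fibre A p\<^esub> br p p)"
        unfolding eq[OF a b] using a b pV br_fibre by algebra
    qed
  next
    fix b assume b: "b \<in> carrier (fibre A p)"
    show "(\<lambda>a. fibre_bracket A br p a b) \<in> linear_maps K (fibre A p) (fibre A p)"
    proof (rule V.linear_maps_cong[OF V.linear_maps_diff[OF left[OF b] left[OF pV]]])
      fix a assume a: "a \<in> carrier (fibre A p)"
      show "fibre_bracket A br p a b
          = br a b \<ominus>\<^bsub>fibre A p\<^esub> br p b \<ominus>\<^bsub>fibre A p\<^esub> (br a p \<ominus>\<^bsub>fibre A p\<^esub> br p p)"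
        unfolding eq[OF a b] using a b pV br_fibre by algebra
    qed
  next
    fix a b assume a: "a \<in> carrier (fibre A p)" and b: "b \<in> carrier (fibre A p)"
    show "br a b = fibre_bracket A br p a b \<oplus>\<^bsub>fibre A p\<^esub> (br a p \<ominus>\<^bsub>fibre A p\<^esub> br p p)
        \<oplus>\<^bsub>fibre A p\<^esub> (br p b \<ominus>\<^bsub>fibre A p\<^esub> br p p) \<oplus>\<^bsub>fibre A p\<^esub> br p p"
      unfolding eq[OF a b] using a b pV br_fibre by algebra
    show "br a b \<ominus>\<^bsub>fibre A p\<^esub> br a a \<oplus>\<^bsub>fibre A p\<^esub> br b a = br b b"
      using a b affine_antisymmetry[of a b]
      by (simp add: fibre_simps(1) tern_in_fibre[OF p, symmetric] br_closed)
  qed (use left right pV br_fibre in blast)+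
qed

lemma hom_lie_algebra_fibre:
  assumes p: "p \<in> carrier A" and fixed: "\<alpha> p = p"
  shows "hom_lie_algebra K (fibre A p) (fibre_bracket A br p) \<alpha>"
proof -
  interpret D: bilinear_decomposition K "fibre A p" "fibre_bracket A br p"
    "\<lambda>a. br a p \<ominus>\<^bsub>fibre A p\<^esub> br p p" "\<lambda>b. br p b \<ominus>\<^bsub>fibre A p\<^esub> br p p" "br p p" br
    using fibre_bracket_decomposition[OF p] .
  have twist: "\<alpha> \<in> linear_maps K (fibre A p) (fibre A p)"
    using affine_map_linear_on_fibres[OF twist_affine p] by (simp add: fixed)
  have Jacobi: "br (\<alpha> a) (br b c) \<ominus>\<^bsub>fibre A p\<^esub> br (\<alpha> a) (br a a) \<oplus>\<^bsub>fibre A p\<^esub> br (\<alpha> b) (br c a)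
      \<ominus>\<^bsub>fibre A p\<^esub> br (\<alpha> b) (br b b) \<oplus>\<^bsub>fibre A p\<^esub> br (\<alpha> c) (br a b) = br (\<alpha> c) (br c c)"
    if "a \<in> carrier (fibre A p)" "b \<in> carrier (fibre A p)" "c \<in> carrier (fibre A p)" for a b c
    using that affine_hom_Jacobi[of a b c] unfolding tern5_def
    by (simp add: fibre_simps(1) tern_in_fibre[OF p, symmetric] br_closed twist_closed tern_closed)
  show ?thesis
  proof (intro hom_lie_algebra.intro hom_lie_algebra_axioms.intro)
    show "field K" ..
    show "module K (fibre A p)"
      by (rule module_fibre[OF p])
  next
    fix a b c
    assume "a \<in> carrier (fibre A p)" "b \<in> carrier (fibre A p)" "c \<in> carrier (fibre A p)"
    with twist Jacobi
    show "fibre_bracket A br p (\<alpha> a) (fibre_bracket A br p b c)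
        \<oplus>\<^bsub>fibre A p\<^esub> fibre_bracket A br p (\<alpha> b) (fibre_bracket A br p c a)
        \<oplus>\<^bsub>fibre A p\<^esub> fibre_bracket A br p (\<alpha> c) (fibre_bracket A br p a b) = \<zero>\<^bsub>fibre A p\<^esub>"
      by (rule D.bilinear_part_hom_Jacobi)
  qed (fact D.B_linear_right D.B_linear_left D.bilinear_part_skew twist)+
qed

text \<open>The bracket at an arbitrary point \<open>q\<close>, computed in the fibre at \<open>p\<close>, so that brackets at
  different points can be compared.\<close>

lemma fibre_bracket_mixed_difference:
  assumes p: "p \<in> carrier A" and q: "q \<in> carrier A" and a: "a \<in> carrier A" and b: "b \<in> carrier A"
  shows "fibre_bracket A br q a b = (br a b \<ominus>\<^bsub>fibre A p\<^esub> br a q) \<ominus>\<^bsub>fibre A p\<^esub> (br q b \<ominus>\<^bsub>fibre A p\<^esub> br q q) \<oplus>\<^bsub>fibre A p\<^esub> q"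
proof -
  interpret V: abelian_group "fibre A p"
    using abelian_group_fibre[OF p] .
  have br_fibre: "br x y \<in> carrier (fibre A p)" if "x \<in> carrier A" "y \<in> carrier A" for x y
    using that by (simp add: fibre_simps br_closed)
  have "fibre_bracket A br q a b = br a b \<ominus>\<^bsub>fibre A p\<^esub> br a q \<oplus>\<^bsub>fibre A p\<^esub> br q q \<ominus>\<^bsub>fibre A p\<^esub> br q b \<oplus>\<^bsub>fibre A p\<^esub> q"
    unfolding fibre_bracket_def tern5_def
    using q a b by (simp add: tern_in_fibre[OF p, symmetric] br_closed tern_closed)
  also have "br a b \<ominus>\<^bsub>fibre A p\<^esub> br a q \<oplus>\<^bsub>fibre A p\<^esub> br q q \<ominus>\<^bsub>fibre A p\<^esub> br q b = (br a b \<ominus>\<^bsub>fibre A p\<^esub> br a q) \<ominus>\<^bsub>fibre A p\<^esub> (br q b \<ominus>\<^bsub>fibre A p\<^esub> br q q)"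
    using br_fibre[OF a b] br_fibre[OF a q] br_fibre[OF q b] br_fibre[OF q q] by algebra
  finally show ?thesis .
qed

text \<open>A difference \<open>{x, y} - {x', y}\<close> is unchanged if \<open>x\<close> and \<open>x'\<close> are translated by the same
  vector, since \<open>{-, y}\<close> preserves the heap operation; likewise in the second argument. Grouping
  the mixed difference by rows and then by columns moves both base points from \<open>e\<close> to \<open>p\<close>.\<close>

lemma fibre_bracket_translation:
  assumes p: "p \<in> carrier A" and e: "e \<in> carrier A" and a: "a \<in> carrier A" and b: "b \<in> carrier A"
  shows "tern A (fibre_bracket A br p a b) p e
    = fibre_bracket A br e (tern A a p e) (tern A b p e)"
proof -
  interpret V: abelian_group "fibre A p"
    using abelian_group_fibre[OF p] .
  have br_fibre: "br x y \<in> carrier (fibre A p)" if "x \<in> carrier A" "y \<in> carrier A" for x y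
    using that by (simp add: fibre_simps br_closed)
  have pt: "p \<in> carrier (fibre A p)" "e \<in> carrier (fibre A p)"
    using p e by (simp_all add: fibre_simps)
  have cancel: "u \<ominus>\<^bsub>fibre A p\<^esub> v \<oplus>\<^bsub>fibre A p\<^esub> w \<ominus>\<^bsub>fibre A p\<^esub> w = u \<ominus>\<^bsub>fibre A p\<^esub> v"
    if "u \<in> carrier (fibre A p)" "v \<in> carrier (fibre A p)" "w \<in> carrier (fibre A p)" for u v w
    using that by algebra
  define a' where "a' = tern A a p e"
  define b' where "b' = tern A b p e"
  have a': "a' \<in> carrier A" and b': "b' \<in> carrier A"
    using p e a b by (simp_all add: a'_def b'_def tern_closed)
  have left: "br a' x \<ominus>\<^bsub>fibre A p\<^esub> br e x = br a x \<ominus>\<^bsub>fibre A p\<^esub> br p x" if x: "x \<in> carrier A" for x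
  proof -
    have "br a' x = br a x \<ominus>\<^bsub>fibre A p\<^esub> br p x \<oplus>\<^bsub>fibre A p\<^esub> br e x"
      unfolding a'_def br_tern_left[OF x a p e] using p e a x by (intro tern_in_fibre br_closed)
    thus ?thesis
      using p e a x by (simp add: cancel br_fibre)
  qed
  have right: "br x b' \<ominus>\<^bsub>fibre A p\<^esub> br x e = br x b \<ominus>\<^bsub>fibre A p\<^esub> br x p" if x: "x \<in> carrier A" for x
  proof -
    have "br x b' = br x b \<ominus>\<^bsub>fibre A p\<^esub> br x p \<oplus>\<^bsub>fibre A p\<^esub> br x e"
      unfolding b'_def br_tern_right[OF x b p e] using p e b x by (intro tern_in_fibre br_closed)
    thus ?thesis
      using p e b x by (simp add: cancel br_fibre)
  qed
  have "fibre_bracket A br e a' b'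
      = (br a' b' \<ominus>\<^bsub>fibre A p\<^esub> br a' e) \<ominus>\<^bsub>fibre A p\<^esub> (br e b' \<ominus>\<^bsub>fibre A p\<^esub> br e e) \<oplus>\<^bsub>fibre A p\<^esub> e"
    using fibre_bracket_mixed_difference[OF p e a' b'] .
  also have "(br a' b' \<ominus>\<^bsub>fibre A p\<^esub> br a' e) \<ominus>\<^bsub>fibre A p\<^esub> (br e b' \<ominus>\<^bsub>fibre A p\<^esub> br e e)
      = (br a' b' \<ominus>\<^bsub>fibre A p\<^esub> br e b') \<ominus>\<^bsub>fibre A p\<^esub> (br a' e \<ominus>\<^bsub>fibre A p\<^esub> br e e)"
    using a' b' e by (intro V.diff_interchange br_fibre)
  also have "\<dots> = (br a b' \<ominus>\<^bsub>fibre A p\<^esub> br p b') \<ominus>\<^bsub>fibre A p\<^esub> (br a e \<ominus>\<^bsub>fibre A p\<^esub> br p e)"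
    using b' e by (simp only: left)
  also have "\<dots> = (br a b' \<ominus>\<^bsub>fibre A p\<^esub> br a e) \<ominus>\<^bsub>fibre A p\<^esub> (br p b' \<ominus>\<^bsub>fibre A p\<^esub> br p e)"
    using a b' p e by (intro V.diff_interchange br_fibre)
  also have "\<dots> = (br a b \<ominus>\<^bsub>fibre A p\<^esub> br a p) \<ominus>\<^bsub>fibre A p\<^esub> (br p b \<ominus>\<^bsub>fibre A p\<^esub> br p p)"
    using a p by (simp only: right)
  also have "\<dots> = fibre_bracket A br p a b"
  proof -
    have "\<dots> \<in> carrier A"
      using a b p by (intro V.minus_closed[unfolded fibre_simps(1)] br_closed)
    thus ?thesis
      using p by (simp add: fibre_bracket_mixed_difference[OF p p a b] fibre_simps(3) tern_right)
  qed
  also have "\<dots> \<oplus>\<^bsub>fibre A p\<^esub> e = tern A \<dots> p e"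
    by (rule fibre_simps(3))
  finally show ?thesis
    by (simp add: a'_def b'_def)
qed

lemma fibres_hom_lie_isomorphic:
  assumes p: "p \<in> carrier A" and e: "e \<in> carrier A" and fixed: "\<alpha> p = p" "\<alpha> e = e"
  shows "hom_lie_isomorphic K (fibre A p) (fibre_bracket A br p) \<alpha>
    (fibre A e) (fibre_bracket A br e) \<alpha>"
proof -
  have "tern A (\<alpha> a) p e = \<alpha> (tern A a p e)" if "a \<in> carrier A" for a
    using twist_affine that p e fixed by (auto simp: affine_map_def heap_hom_def)
  thus ?thesis
    unfolding hom_lie_isomorphic_def
    using translation_linear[OF p e] translation_bij[OF p e] fibre_bracket_translation[OF p e]
    by (intro bexI[of _ "\<lambda>a. tern A a p e"]) (simp_all add: fibre_simps(1))
qed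

end

section \<open>The fibre Hom-Lie algebras and their isomorphism\<close>

theorem theorem5p1:
  fixes K :: "('k, 'r) ring_scheme" and A :: "('k, 'a, 'm) affine_scheme"
    and br :: "'a \<Rightarrow> 'a \<Rightarrow> 'a" and \<alpha> :: "'a \<Rightarrow> 'a"
  assumes "field K" and "ring_characteristic K \<noteq> 2"
    and "multiplicative_hom_lie_affgebra K A br \<alpha>"
  shows "(\<forall>p\<in>carrier A. \<alpha> p = p \<longrightarrow>
           hom_lie_algebra K (fibre A p) (fibre_bracket A br p) \<alpha> \<and>
           (\<forall>a\<in>carrier A. \<forall>b\<in>carrier A.
              fibre_bracket A br p a b
              = br a b \<ominus>\<^bsub>fibre A p\<^esub> br a p \<oplus>\<^bsub>fibre A p\<^esub> br p p \<ominus>\<^bsub>fibre A p\<^esub> br p b)) \<and>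
         (\<forall>p\<in>carrier A. \<forall>e\<in>carrier A. \<alpha> p = p \<longrightarrow> \<alpha> e = e \<longrightarrow>
           hom_lie_isomorphic K (fibre A p) (fibre_bracket A br p) \<alpha>
                                (fibre A e) (fibre_bracket A br e) \<alpha>)"
proof -
  interpret multiplicative_hom_lie_affgebra K A br \<alpha>
    using assms(3) .
  show ?thesis
    by (intro conjI ballI impI hom_lie_algebra_fibre fibre_bracket_eq fibres_hom_lie_isomorphic)
qed

end
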